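(* Let $F$ be a field, $A\in F^{n\times n}$ and $0\neq\lambda\in F$. Let $A_{\mathrm{nil}}$ and $A_{\mathrm{inv}}$ be the nilpotent and invertible parts of $A$. Then $$C_F(A,\lambda)\cong C_F(A_{\mathrm{nil}},\lambda)\oplus C_F(A_{\mathrm{inv}},\lambda)$$ as $F$-vector spaces.
   Context: For a field $F$, a square matrix $A\in F^{m\times m}$ and $\lambda\in F$, $C_F(A,\lambda)=\{B\in F^{m\times m}\mid AB-\lambda BA=0\}$ (the zero space when $m=0$). Matrices act on row vectors from the right. For $A\in F^{n\times n}$ and $V=F^n$ (row vectors), put $V_{\mathrm{nil}}=\{v\in V\mid vA^n=0\}$ and $V_{\mathrm{inv}}=\{vA^n\mid v\in V\}$; then $V=V_{\mathrm{nil}}\oplus V_{\mathrm{inv}}$ and both subspaces are $A$-invariant. Hence $A$ is conjugate to a block diagonal matrix $A_{\mathrm{nil}}\oplus A_{\mathrm{inv}}$, where $A_{\mathrm{nil}}$ (a nilpotent matrix) is the matrix of the restriction of $A$ to $V_{\mathrm{nil}}$ and $A_{\mathrm{inv}}$ (an invertible matrix) is the matrix of the restriction of $A$ to $V_{\mathrm{inv}}$, with respect to chosen bases. Either block may be of size $0\times 0$. *)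

theory Defs
  imports "Jordan_Normal_Form.VS_Connect"
begin

text \<open>Matrices act on row vectors from the right.\<close>

definition vec_mult_mat :: "'a :: semiring_0 vec \<Rightarrow> 'a mat \<Rightarrow> 'a vec" (infixl \<open>\<^sub>v*\<close> 70) where
  "v \<^sub>v* A = vec (dim_col A) (\<lambda>j. v \<bullet> col A j)"

definition nil_space :: "'a :: field mat \<Rightarrow> 'a vec set" where
  "nil_space A = {v \<in> carrier_vec (dim_row A). v \<^sub>v* (A ^\<^sub>m dim_row A) = 0\<^sub>v (dim_row A)}"

definition inv_space :: "'a :: field mat \<Rightarrow> 'a vec set" where
  "inv_space A = {v \<^sub>v* (A ^\<^sub>m dim_row A) | v. v \<in> carrier_vec (dim_row A)}"

definition ordered_basis :: "nat \<Rightarrow> 'a :: field vec set \<Rightarrow> 'a vec list \<Rightarrow> bool" where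
  "ordered_basis n W bs \<longleftrightarrow> distinct bs \<and>
     vectorspace.basis class_ring ((module_vec TYPE('a) n)\<lparr>carrier := W\<rparr>) (set bs)"

text \<open>Row \<open>i\<close> of \<open>M\<close> holds the coordinates of the image of the \<open>i\<close>-th basis vector,
  as is usual for row vectors. The empty basis of the zero space gives the \<open>0 \<times> 0\<close> matrix.\<close>

definition represents_on :: "'a :: field mat \<Rightarrow> 'a vec list \<Rightarrow> 'a mat \<Rightarrow> bool" where
  "represents_on A bs M \<longleftrightarrow> M \<in> carrier_mat (length bs) (length bs) \<and>
     (\<forall>i < length bs. bs ! i \<^sub>v* A =
        finsum_vec TYPE('a) (dim_row A) (\<lambda>j. M $$ (i, j) \<cdot>\<^sub>v bs ! j) {..<length bs})"

text \<open>\<open>M\<close> is the matrix, with respect to some basis, of the restriction of \<open>A\<close> to the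
  \<open>A\<close>-invariant subspace \<open>W\<close>.\<close>

definition restriction_matrix :: "'a :: field mat \<Rightarrow> 'a vec set \<Rightarrow> 'a mat \<Rightarrow> bool" where
  "restriction_matrix A W M \<longleftrightarrow> (\<exists>bs. ordered_basis (dim_row A) W bs \<and> represents_on A bs M)"

definition is_nil_part :: "'a :: field mat \<Rightarrow> 'a mat \<Rightarrow> bool" where
  "is_nil_part A M \<longleftrightarrow> restriction_matrix A (nil_space A) M"

definition is_inv_part :: "'a :: field mat \<Rightarrow> 'a mat \<Rightarrow> bool" where
  "is_inv_part A M \<longleftrightarrow> restriction_matrix A (inv_space A) M"

definition C_set :: "'a :: field mat \<Rightarrow> 'a \<Rightarrow> 'a mat set" where
  "C_set A l = {B \<in> carrier_mat (dim_row A) (dim_row A).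
     A * B - l \<cdot>\<^sub>m (B * A) = 0\<^sub>m (dim_row A) (dim_row A)}"

definition C_space :: "'a :: field mat \<Rightarrow> 'a \<Rightarrow> ('a, 'a mat) module" where
  "C_space A l = (module_mat TYPE('a) (dim_row A) (dim_row A))\<lparr>carrier := C_set A l\<rparr>"

text \<open>The locale \<^locale>\<open>linear_map\<close> includes that \<open>V\<close> and \<open>W\<close> are vector spaces over \<open>K\<close>.\<close>

definition vs_isomorphic ::
  "('k, 'e) ring_scheme \<Rightarrow> ('k, 'v, 'f) module_scheme \<Rightarrow> ('k, 'w, 'g) module_scheme \<Rightarrow> bool" where
  "vs_isomorphic K V W \<longleftrightarrow> (\<exists>T. linear_map K V W T \<and> bij_betw T (carrier V) (carrier W))"

end

theory Submission
  imports Defs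
begin

text \<open>
  Put \<open>N = A\<^sup>n\<close>. The Fitting decomposition writes the row space \<open>F\<^sup>n\<close> as the direct sum of
  the kernel \<open>{v. v N = 0}\<close> and the image of \<open>v \<mapsto> v N\<close>. A matrix \<open>B\<close> with \<open>A B = \<lambda> B A\<close> also satisfies
  \<open>N B = \<lambda>\<^sup>n B N\<close>, and since \<open>\<lambda>\<^sup>n \<noteq> 0\<close> this makes both summands invariant under \<open>B\<close>: if
  \<open>v N = 0\<close> then \<open>\<lambda>\<^sup>n (v B) N = v N B = 0\<close>, and \<open>(v N) B = \<lambda>\<^sup>n (v B) N\<close>. So \<open>B\<close> is block
  diagonal in a basis adapted to the decomposition. As \<open>A\<close> is block diagonal there too, the relation
  for \<open>B\<close> amounts to the same relation for each of the two diagonal blocks separately.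

  Block matrices and the equality of \<open>n\<close> with the sum of the two dimensions are avoided as follows.
  Let \<open>P\<^sub>1\<close> and \<open>P\<^sub>2\<close> be the rectangular matrices whose rows are the two given bases, and let the
  rows of \<open>Q\<^sub>1\<close> and \<open>Q\<^sub>2\<close> be the coordinates of the components of the unit vectors. Then
  \<open>Q\<^sub>1 P\<^sub>1 + Q\<^sub>2 P\<^sub>2 = 1\<close>, \<open>P\<^sub>i Q\<^sub>i = 1\<close>, and \<open>P\<^sub>1 Q\<^sub>2\<close> and \<open>P\<^sub>2 Q\<^sub>1\<close> vanish
  (lemma \<open>fitting_coordinates\<close>). The isomorphism is \<open>B \<mapsto> (P\<^sub>1 B Q\<^sub>1, P\<^sub>2 B Q\<^sub>2)\<close> with inverse
  \<open>(X, Y) \<mapsto> Q\<^sub>1 X P\<^sub>1 + Q\<^sub>2 Y P\<^sub>2\<close>. Both maps respect the commutation relation for the same reason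
  (lemma \<open>C_set_transfer\<close>), and reassembling \<open>B\<close> from its diagonal blocks
  loses nothing because the off-diagonal blocks \<open>P\<^sub>1 B Q\<^sub>2\<close> and \<open>P\<^sub>2 B Q\<^sub>1\<close> vanish by the
  invariance above.

  The Fitting decomposition itself comes from linear dependence alone. For a row \<open>x\<close> the
  \<open>n + 1\<close> rows \<open>x, x A, \<dots>, x A\<^sup>n\<close> are dependent. Dividing a dependency by its lowest nonzero
  coefficient gives \<open>x A\<^sup>n = x A\<^sup>n\<^sup>+\<^sup>1 R\<close> for some polynomial \<open>R\<close> in \<open>A\<close>, hence
  \<open>x N = x N\<^sup>2 R'\<close> with \<open>R'\<close> commuting with \<open>A\<close>. This single identity shows
  both that \<open>x N\<^sup>2 = 0\<close> implies \<open>x N = 0\<close>, so the sum is direct, and that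
  \<open>x N\<close> lies in the row space of \<open>N\<^sup>2\<close>, so the sum is everything.
\<close>

section \<open>Matrix products and powers\<close>

lemma pow_mat_add:
  fixes A :: "'a :: field mat"
  assumes A: "A \<in> carrier_mat n n"
  shows "A ^\<^sub>m (j + k) = A ^\<^sub>m j * A ^\<^sub>m k"
proof (induction k)
  case 0
  show ?case using right_mult_one_mat[OF pow_carrier_mat[OF A, of j]] carrier_matD[OF A] by simp
next
  case (Suc k)
  then show ?case
    using assoc_mult_mat[OF pow_carrier_mat[OF A] pow_carrier_mat[OF A] A] by simp
qed

text \<open>
  The ring laws for rectangular matrices are restated with side conditions on dimensions.
  With the carrier formulation the rewriter would have to guess the inner dimensions of a product;
  here every side condition reduces to the known dimensions of the factors.
\<close>

lemma mult_assoc_dim: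
  fixes A :: "'a :: semiring_0 mat"
  assumes "dim_col A = dim_row B" "dim_col B = dim_row C"
  shows "(A * B) * C = A * (B * C)"
proof (rule assoc_mult_mat)
  show "A \<in> carrier_mat (dim_row A) (dim_row B)" using assms(1) by (intro carrier_matI) simp_all
  show "B \<in> carrier_mat (dim_row B) (dim_row C)" using assms(2) by (intro carrier_matI) simp_all
  show "C \<in> carrier_mat (dim_row C) (dim_col C)" by (intro carrier_matI) simp_all
qed

lemma mult_add_dim:
  fixes A :: "'a :: semiring_0 mat"
  assumes "dim_col A = dim_row B" "dim_row B = dim_row C" "dim_col B = dim_col C"
  shows "A * (B + C) = A * B + A * C"
proof (rule mult_add_distrib_mat)
  show "A \<in> carrier_mat (dim_row A) (dim_row B)" using assms(1) by (intro carrier_matI) simp_all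
  show "B \<in> carrier_mat (dim_row B) (dim_col B)" by (intro carrier_matI) simp_all
  show "C \<in> carrier_mat (dim_row B) (dim_col B)" using assms(2,3) by (intro carrier_matI) simp_all
qed

lemma add_mult_dim:
  fixes A :: "'a :: semiring_0 mat"
  assumes "dim_col A = dim_row C" "dim_row A = dim_row B" "dim_col A = dim_col B"
  shows "(A + B) * C = A * C + B * C"
proof (rule add_mult_distrib_mat)
  show "A \<in> carrier_mat (dim_row A) (dim_col A)" by (intro carrier_matI) simp_all
  show "B \<in> carrier_mat (dim_row A) (dim_col A)" using assms(2,3) by (intro carrier_matI) simp_all
  show "C \<in> carrier_mat (dim_col A) (dim_col C)" using assms(1) by (intro carrier_matI) simp_all
qed

lemma smult_mult_dim:
  fixes A :: "'a :: comm_semiring_0 mat"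
  assumes "dim_col A = dim_row C"
  shows "(k \<cdot>\<^sub>m A) * C = k \<cdot>\<^sub>m (A * C)" "A * (k \<cdot>\<^sub>m C) = k \<cdot>\<^sub>m (A * C)"
proof -
  have "A \<in> carrier_mat (dim_row A) (dim_row C)" "C \<in> carrier_mat (dim_row C) (dim_col C)"
    using assms by (intro carrier_matI; simp)+
  then show "(k \<cdot>\<^sub>m A) * C = k \<cdot>\<^sub>m (A * C)" "A * (k \<cdot>\<^sub>m C) = k \<cdot>\<^sub>m (A * C)"
    by (rule mult_smult_assoc_mat, rule mult_smult_distrib)
qed

lemmas mat_ring_simps = mult_assoc_dim mult_add_dim add_mult_dim smult_mult_dim

lemma mat_mult_pow_Suc:
  assumes A: "A \<in> carrier_mat n n" and X: "X \<in> carrier_mat m n"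
  shows "X * A ^\<^sub>m Suc k = (X * A) * A ^\<^sub>m k"
proof (induction k)
  case 0
  then show ?case using A X by (simp add: assoc_mult_mat[OF X A])
next
  case (Suc k)
  have p: "A ^\<^sub>m k \<in> carrier_mat n n" "A ^\<^sub>m Suc k \<in> carrier_mat n n"
    using A by (simp_all only: pow_carrier_mat)
  have "X * A ^\<^sub>m Suc (Suc k) = (X * A ^\<^sub>m Suc k) * A"
    using assoc_mult_mat[OF X p(2) A] by simp
  also have "\<dots> = ((X * A) * A ^\<^sub>m k) * A" using Suc.IH by simp
  also have "\<dots> = (X * A) * A ^\<^sub>m Suc k"
    using assoc_mult_mat[OF mult_carrier_mat[OF X A] p(1) A] by simp
  finally show ?case .
qed

lemma one_smult_mat [simp]: "(1 :: 'a :: field) \<cdot>\<^sub>m B = B"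
  by (rule eq_matI) auto

text \<open>
  Moving one factor \<open>A\<close> past \<open>B\<close> costs one factor \<open>l\<close>. The case \<open>l = 1\<close> is ordinary commutation.
\<close>

lemma twisted_commute_pow:
  fixes A B :: "'a :: field mat"
  assumes A: "A \<in> carrier_mat n n" and B: "B \<in> carrier_mat n n"
    and comm: "A * B = l \<cdot>\<^sub>m (B * A)"
  shows "A ^\<^sub>m k * B = l ^ k \<cdot>\<^sub>m (B * A ^\<^sub>m k)"
proof (induction k)
  case 0
  then show ?case using A B by simp
next
  case (Suc k)
  have p: "A ^\<^sub>m k \<in> carrier_mat n n" using A by simp
  have "A ^\<^sub>m Suc k * B = A ^\<^sub>m k * (A * B)" using assoc_mult_mat[OF p A B] by simp
  also have "\<dots> = l \<cdot>\<^sub>m (A ^\<^sub>m k * (B * A))"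
    unfolding comm by (rule mult_smult_distrib[OF p mult_carrier_mat[OF B A]])
  also have "A ^\<^sub>m k * (B * A) = (A ^\<^sub>m k * B) * A" using assoc_mult_mat[OF p B A] by simp
  also have "\<dots> = l ^ k \<cdot>\<^sub>m ((B * A ^\<^sub>m k) * A)"
    unfolding Suc.IH by (rule mult_smult_assoc_mat[OF mult_carrier_mat[OF B p] A])
  also have "(B * A ^\<^sub>m k) * A = B * A ^\<^sub>m Suc k" using assoc_mult_mat[OF B p A] by simp
  also have "l \<cdot>\<^sub>m (l ^ k \<cdot>\<^sub>m (B * A ^\<^sub>m Suc k)) = l ^ Suc k \<cdot>\<^sub>m (B * A ^\<^sub>m Suc k)"
    by (rule eq_matI) (simp_all add: mult.assoc del: index_mult_mat(1))
  finally show ?case .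
qed

lemma commute_pow:
  fixes A R :: "'a :: field mat"
  assumes A: "A \<in> carrier_mat n n" and R: "R \<in> carrier_mat n n" and comm: "R * A = A * R"
  shows "R * A ^\<^sub>m k = A ^\<^sub>m k * R"
  using twisted_commute_pow[OF A R, of 1 k] by (simp add: comm)

section \<open>The Fitting decomposition\<close>

text \<open>
  The value at \<open>A\<close> of the polynomial with coefficient list \<open>cs\<close>, lowest coefficient first.
  The Horner form exposes the factor \<open>A\<close> that is left over once the constant coefficient is split
  off, which is what the induction in \<open>pow_factors_of_annihilating_list\<close> consumes.
\<close>

primrec horner_mat :: "'a :: field mat \<Rightarrow> 'a list \<Rightarrow> 'a mat" where
  "horner_mat A [] = 0\<^sub>m (dim_row A) (dim_row A)"
| "horner_mat A (c # cs) = c \<cdot>\<^sub>m 1\<^sub>m (dim_row A) + A * horner_mat A cs"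

lemma horner_mat_carrier [simp]:
  "A \<in> carrier_mat n n \<Longrightarrow> horner_mat A cs \<in> carrier_mat n n"
  by (induction cs) auto

lemma horner_mat_commute:
  assumes A: "A \<in> carrier_mat n n"
  shows "horner_mat A cs * A = A * horner_mat A cs"
proof (induction cs)
  case Nil
  then show ?case using A by simp
next
  case (Cons c cs)
  let ?H = "horner_mat A cs"
  have H: "?H \<in> carrier_mat n n" using A by simp
  have "horner_mat A (c # cs) * A = c \<cdot>\<^sub>m A + (A * ?H) * A"
    using A H by (simp add: add_mult_distrib_mat[of _ n n _ _ n] mult_smult_assoc_mat[of _ n n _ n])
  also have "(A * ?H) * A = A * (A * ?H)"
    using A H Cons.IH by (simp add: assoc_mult_mat[of _ n n _ n _ n])
  also have "c \<cdot>\<^sub>m A + A * (A * ?H) = A * horner_mat A (c # cs)"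
    using A H by (simp add: mult_add_distrib_mat[of _ n n _ n] mult_smult_distrib[of _ n n _ n])
  finally show ?case .
qed

lemma horner_mat_index:
  assumes A: "A \<in> carrier_mat n n" and X: "X \<in> carrier_mat m n" and ij: "i < m" "j < n"
  shows "(X * horner_mat A cs) $$ (i, j) = (\<Sum>k<length cs. cs ! k * (X * A ^\<^sub>m k) $$ (i, j))"
  using X
proof (induction cs arbitrary: X)
  case Nil
  then show ?case using A ij by simp
next
  case (Cons c cs)
  let ?H = "horner_mat A cs"
  have H: "?H \<in> carrier_mat n n" using A by simp
  have XA: "X * A \<in> carrier_mat m n" using A Cons.prems by simp
  have X1: "X * 1\<^sub>m n = X" using Cons.prems by simp
  have "X * horner_mat A (c # cs) = c \<cdot>\<^sub>m X + (X * A) * ?H"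
    using A H Cons.prems X1
    by (simp add: mult_add_distrib_mat[of _ m n _ n] mult_smult_distrib[of _ m n _ n]
        assoc_mult_mat[of _ m n _ n _ n])
  then have "(X * horner_mat A (c # cs)) $$ (i, j) = c * X $$ (i, j) + ((X * A) * ?H) $$ (i, j)"
    using ij Cons.prems H XA by (simp del: index_mult_mat(1))
  also have "((X * A) * ?H) $$ (i, j) = (\<Sum>k<length cs. cs ! k * (X * A ^\<^sub>m Suc k) $$ (i, j))"
    unfolding Cons.IH[OF XA] mat_mult_pow_Suc[OF A Cons.prems] ..
  finally show ?case
    using A Cons.prems X1 by (simp add: sum.lessThan_Suc_shift
        del: sum.lessThan_Suc index_mult_mat(1) pow_mat.simps(2))
qed

text \<open>
  The \<open>n + 1\<close> rows \<open>X A\<^sup>k\<close>, \<open>k \<le> n\<close>, live in dimension \<open>n\<close> and are therefore dependent. Written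
  as columns and completed by a zero row they form a square matrix of determinant zero, whose
  kernel supplies the coefficients.
\<close>

lemma annihilating_list_exists:
  fixes X :: "'a :: field mat"
  assumes A: "A \<in> carrier_mat n n" and X: "X \<in> carrier_mat 1 n"
  shows "\<exists>cs. length cs = Suc n \<and> (\<exists>c\<in>set cs. c \<noteq> 0) \<and> X * horner_mat A cs = 0\<^sub>m 1 n"
proof -
  define M where "M = mat\<^sub>r (Suc n) (Suc n) (\<lambda>j. if j = n then 0\<^sub>v (Suc n)
    else vec (Suc n) (\<lambda>k. (X * A ^\<^sub>m k) $$ (0, j)))"
  have M: "M \<in> carrier_mat (Suc n) (Suc n)" by (simp add: M_def)
  have "det M = 0" unfolding M_def by (rule det_row_0) auto
  then obtain v where v: "v \<in> carrier_vec (Suc n)" "v \<noteq> 0\<^sub>v (Suc n)" "M *\<^sub>v v = 0\<^sub>v (Suc n)"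
    using det_0_iff_vec_prod_zero_field[OF M] by auto
  have len: "length (list_of_vec v) = Suc n" using v(1) by simp
  have "(X * horner_mat A (list_of_vec v)) $$ (0, j) = 0" if j: "j < n" for j
  proof -
    have "(M *\<^sub>v v) $ j = (\<Sum>k<Suc n. (X * A ^\<^sub>m k) $$ (0, j) * v $ k)"
    proof -
      have "M $$ (j, k) = (X * A ^\<^sub>m k) $$ (0, j)" if "k < Suc n" for k
        using j that by (simp add: M_def del: index_mult_mat(1))
      then show ?thesis
        using j v(1) M by (simp add: scalar_prod_def atLeast0LessThan
            del: index_mult_mat(1) sum.lessThan_Suc)
    qed
    moreover have "(M *\<^sub>v v) $ j = 0" using v(3) j by simp
    ultimately show ?thesis
      using horner_mat_index[OF A X _ j, of 0 "list_of_vec v"] len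
      by (simp add: list_of_vec_index mult.commute del: index_mult_mat(1) sum.lessThan_Suc)
  qed
  then have "X * horner_mat A (list_of_vec v) = 0\<^sub>m 1 n"
    using X horner_mat_carrier[OF A, of "list_of_vec v"] by (intro eq_matI) (auto simp del: index_mult_mat(1))
  moreover have "\<exists>c\<in>set (list_of_vec v). c \<noteq> 0"
  proof -
    obtain k where "k < Suc n" "v $ k \<noteq> 0"
      using v(1,2) eq_vecI[of v "0\<^sub>v (Suc n)"] by auto
    then show ?thesis using len nth_mem[of k "list_of_vec v"] by (auto simp: list_of_vec_index)
  qed
  ultimately show ?thesis using len by blast
qed

text \<open>
  Splitting off vanishing low coefficients replaces \<open>X\<close> by \<open>X A\<close> and shortens the list, which uses
  up one unit of \<open>k\<close>. At the first nonzero coefficient \<open>c\<close> the relation \<open>c X + X A H = 0\<close> can be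
  solved for \<open>X\<close>, with \<open>R = - H / c\<close>.
\<close>

lemma pow_factors_of_annihilating_list:
  fixes X :: "'a :: field mat"
  assumes A: "A \<in> carrier_mat n n"
  shows "X \<in> carrier_mat m n \<Longrightarrow> X * horner_mat A cs = 0\<^sub>m m n \<Longrightarrow> \<exists>c\<in>set cs. c \<noteq> 0 \<Longrightarrow>
    length cs \<le> Suc k \<Longrightarrow>
    \<exists>R. R \<in> carrier_mat n n \<and> R * A = A * R \<and> X * A ^\<^sub>m k = X * A ^\<^sub>m Suc k * R"
proof (induction cs arbitrary: X k)
  case Nil
  then show ?case by simp
next
  case (Cons c cs)
  note X = Cons.prems(1)
  let ?H = "horner_mat A cs"
  have H: "?H \<in> carrier_mat n n" using A by simp
  have XA: "X * A \<in> carrier_mat m n" using A X by simp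
  have X1: "X * 1\<^sub>m n = X" using X by simp
  have "X * horner_mat A (c # cs) = c \<cdot>\<^sub>m X + (X * A) * ?H"
    using A H X X1
    by (simp add: mult_add_distrib_mat[of _ m n _ n] mult_smult_distrib[of _ m n _ n]
        assoc_mult_mat[of _ m n _ n _ n])
  then have eq: "c \<cdot>\<^sub>m X + (X * A) * ?H = 0\<^sub>m m n" using Cons.prems(2) by simp
  show ?case
  proof (cases "c = 0")
    case True
    have "(X * A) * ?H = 0\<^sub>m m n"
    proof -
      have "0 \<cdot>\<^sub>m X = 0\<^sub>m m n" using X by (intro eq_matI) auto
      then show ?thesis using eq True XA H left_add_zero_mat[of "(X * A) * ?H" m n] by simp
    qed
    moreover obtain k' where k: "k = Suc k'" "length cs \<le> Suc k'"
      using Cons.prems(3,4) True by (cases k) auto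
    ultimately obtain R where R: "R \<in> carrier_mat n n" "R * A = A * R"
        "(X * A) * A ^\<^sub>m k' = (X * A) * A ^\<^sub>m Suc k' * R"
      using Cons.IH[OF XA, of k'] Cons.prems(3) True by auto
    have "X * A ^\<^sub>m k = X * A ^\<^sub>m Suc k * R"
      unfolding k(1) mat_mult_pow_Suc[OF A X] by (rule R(3))
    then show ?thesis using R by blast
  next
    case False
    define R where "R = (- inverse c) \<cdot>\<^sub>m ?H"
    have R: "R \<in> carrier_mat n n" using H by (simp add: R_def)
    have RA: "R * A = A * R"
      using A H horner_mat_commute[OF A, of cs]
      by (simp add: R_def mult_smult_assoc_mat[of _ n n _ n] mult_smult_distrib[of _ n n _ n])
    have XR: "X = (X * A) * R"
    proof (rule eq_matI)
      fix i j assume "i < dim_row ((X * A) * R)" "j < dim_col ((X * A) * R)"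
      then have ij: "i < m" "j < n" using X R by auto
      have "(c \<cdot>\<^sub>m X + (X * A) * ?H) $$ (i, j) = 0" using eq ij by simp
      then have "c * X $$ (i, j) + ((X * A) * ?H) $$ (i, j) = 0"
        using ij X XA H by (simp del: index_mult_mat(1))
      then have "c * X $$ (i, j) = - ((X * A) * ?H) $$ (i, j)"
        by (simp only: eq_neg_iff_add_eq_0)
      moreover have "((X * A) * R) $$ (i, j) = - inverse c * ((X * A) * ?H) $$ (i, j)"
        using ij X H unfolding R_def mult_smult_distrib[OF XA H] by simp
      then have "c * ((X * A) * R) $$ (i, j) = - ((X * A) * ?H) $$ (i, j)"
        using False by (simp del: index_mult_mat(1))
      ultimately have "c * X $$ (i, j) = c * ((X * A) * R) $$ (i, j)" by (simp only:)
      then show "X $$ (i, j) = ((X * A) * R) $$ (i, j)"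
        unfolding mult_left_cancel[OF False] .
    qed (use X R in auto)
    have "X * A ^\<^sub>m k = X * A ^\<^sub>m Suc k * R"
    proof -
      have p: "A ^\<^sub>m k \<in> carrier_mat n n" using A by simp
      have "X * A ^\<^sub>m k = ((X * A) * R) * A ^\<^sub>m k" using XR by simp
      also have "\<dots> = (X * A) * (R * A ^\<^sub>m k)" by (rule assoc_mult_mat[OF XA R p])
      also have "\<dots> = ((X * A) * A ^\<^sub>m k) * R"
        unfolding commute_pow[OF A R RA] by (rule assoc_mult_mat[OF XA p R, symmetric])
      finally show ?thesis unfolding mat_mult_pow_Suc[OF A X] .
    qed
    then show ?thesis using R RA by blast
  qed
qed

text \<open>
  Substituting the relation into itself raises the exponent on the right arbitrarily, because \<open>S\<close>
  commutes with \<open>A\<close> and can be moved out of the way.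
\<close>

lemma pow_factors_iterate:
  fixes X :: "'a :: field mat"
  assumes A: "A \<in> carrier_mat n n" and X: "X \<in> carrier_mat m n"
    and S: "S \<in> carrier_mat n n" "S * A = A * S" "X * A ^\<^sub>m d = X * A ^\<^sub>m Suc d * S"
  shows "\<exists>R. R \<in> carrier_mat n n \<and> R * A = A * R \<and> X * A ^\<^sub>m d = X * A ^\<^sub>m (d + k) * R"
proof (induction k)
  case 0
  have "X * A ^\<^sub>m d = X * A ^\<^sub>m (d + 0) * 1\<^sub>m n"
    using right_mult_one_mat[OF mult_carrier_mat[OF X pow_carrier_mat[OF A, of d]]] by simp
  then show ?case using A by (intro exI[of _ "1\<^sub>m n"]) simp
next
  case (Suc k)
  then obtain R where R: "R \<in> carrier_mat n n" "R * A = A * R"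
    "X * A ^\<^sub>m d = X * A ^\<^sub>m (d + k) * R" by blast
  note [simp] = S(1) R(1) A X
  note carriers = mult_carrier_mat[of _ n n _ n] mult_carrier_mat[of _ m n _ n]
  note assoc = assoc_mult_mat[of _ n n _ n _ n] assoc_mult_mat[of _ m n _ n _ n]
  let ?P = "A ^\<^sub>m d" and ?Q = "A ^\<^sub>m (d + k)"
  have "X * ?P = X * (?P * A) * S" using S(3) by simp
  also have "\<dots> = (X * ?P) * (A * S)" by (simp add: assoc carriers)
  also have "\<dots> = (X * ?Q * R) * (A * S)" using R(3) by simp
  also have "\<dots> = X * ?Q * ((R * A) * S)" by (simp add: assoc carriers)
  also have "\<dots> = X * A ^\<^sub>m (d + Suc k) * (R * S)"
    unfolding R(2) by (simp add: assoc carriers)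
  finally have "X * ?P = X * A ^\<^sub>m (d + Suc k) * (R * S)" .
  moreover have "(R * S) * A = A * (R * S)"
    using S(2) R(2) assoc_mult_mat[OF R(1) S(1) A] assoc_mult_mat[OF R(1) A S(1)]
      assoc_mult_mat[OF A R(1) S(1)] by simp
  ultimately show ?case by (intro exI[of _ "R * S"]) (simp add: carriers)
qed

lemma pow_factors_row:
  fixes X :: "'a :: field mat"
  assumes A: "A \<in> carrier_mat n n" and X: "X \<in> carrier_mat 1 n"
  shows "\<exists>R. R \<in> carrier_mat n n \<and> R * A = A * R \<and> X * A ^\<^sub>m n = X * A ^\<^sub>m (n + k) * R"
proof -
  obtain cs where "length cs \<le> Suc n" "\<exists>c\<in>set cs. c \<noteq> 0" "X * horner_mat A cs = 0\<^sub>m 1 n"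
    using annihilating_list_exists[OF A X] by (metis le_refl)
  then obtain S where "S \<in> carrier_mat n n" "S * A = A * S" "X * A ^\<^sub>m n = X * A ^\<^sub>m Suc n * S"
    using pow_factors_of_annihilating_list[OF A X, of cs n] by blast
  then show ?thesis by (rule pow_factors_iterate[OF A X])
qed

text \<open>
  Each row \<open>x\<close> satisfies \<open>x A\<^sup>n = x A\<^sup>2\<^sup>n R\<close> for some \<open>R\<close>, and here the right-hand side vanishes.
  Together with \<open>fitting_image\<close> this expresses that the kernels and the images of the powers of \<open>A\<close>
  are stationary from the exponent \<open>n\<close> on.
\<close>

lemma fitting_kernel:
  fixes X :: "'a :: field mat"
  assumes A: "A \<in> carrier_mat n n" and X: "X \<in> carrier_mat m n"
    and zero: "X * A ^\<^sub>m (n + n) = 0\<^sub>m m n"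
  shows "X * A ^\<^sub>m n = 0\<^sub>m m n"
proof (rule eq_rowI)
  fix i assume "i < dim_row (0\<^sub>m m n :: 'a mat)"
  then have i: "i < m" by simp
  define Y where "Y = mat_of_rows n [row X i]"
  have Y: "Y \<in> carrier_mat 1 n" by (auto simp: Y_def intro: carrier_matI)
  have r: "row Y 0 = row X i" using X i by (simp add: Y_def)
  obtain R where R: "R \<in> carrier_mat n n" "Y * A ^\<^sub>m n = Y * A ^\<^sub>m (n + n) * R"
    using pow_factors_row[OF A Y, of n] by blast
  have rows: "row (Y * A ^\<^sub>m k) 0 = row (X * A ^\<^sub>m k) i" for k
    using A X Y i r by (intro eq_vecI) auto
  have "Y * A ^\<^sub>m (n + n) = 0\<^sub>m 1 n"
  proof (rule eq_rowI)
    fix j assume "j < dim_row (0\<^sub>m 1 n :: 'a mat)"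
    then show "row (Y * A ^\<^sub>m (n + n)) j = row (0\<^sub>m 1 n) j"
      using rows[of "n + n"] zero i by simp
  qed (use A Y in auto)
  then have "Y * A ^\<^sub>m n = 0\<^sub>m 1 n" using R by simp
  then show "row (X * A ^\<^sub>m n) i = row (0\<^sub>m m n) i" using rows[of n] i by simp
qed (use A X in auto)

text \<open>
  For the \<open>i\<close>-th unit row \<open>e\<close> the identity \<open>e A\<^sup>n = e A\<^sup>2\<^sup>n R = (e R) A\<^sup>2\<^sup>n\<close> exhibits the \<open>i\<close>-th row of
  \<open>A\<^sup>n\<close> as a combination of the rows of \<open>A\<^sup>2\<^sup>n\<close>. Here it matters that \<open>R\<close> commutes with \<open>A\<close>.
\<close>

lemma fitting_image:
  fixes A :: "'a :: field mat"
  assumes A: "A \<in> carrier_mat n n"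
  shows "\<exists>W. W \<in> carrier_mat n n \<and> A ^\<^sub>m n = W * A ^\<^sub>m (n + n)"
proof -
  have "\<exists>w. w \<in> carrier_vec n \<and> row (A ^\<^sub>m n) i = row (mat_of_rows n [w] * A ^\<^sub>m (n + n)) 0"
    if i: "i < n" for i
  proof -
    define Y :: "'a mat" where "Y = mat_of_rows n [unit_vec n i]"
    have Y: "Y \<in> carrier_mat 1 n" by (auto simp: Y_def intro: carrier_matI)
    obtain R where R: "R \<in> carrier_mat n n" "R * A = A * R" "Y * A ^\<^sub>m n = Y * A ^\<^sub>m (n + n) * R"
      using pow_factors_row[OF A Y, of n] by blast
    note [simp] = A Y R(1)
    have "row (A ^\<^sub>m n) i = row (Y * A ^\<^sub>m n) 0"
    proof (rule eq_vecI)
      fix j assume "j < dim_vec (row (Y * A ^\<^sub>m n) 0)"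
      then have j: "j < n" using carrier_matD[OF A] by (simp split: if_splits)
      have "col (A ^\<^sub>m n) j \<in> carrier_vec n" using carrier_matD[OF A] by (intro carrier_vecI) simp
      then show "row (A ^\<^sub>m n) i $ j = row (Y * A ^\<^sub>m n) 0 $ j"
        using i j carrier_matD[OF A] by (simp add: Y_def)
    qed (use carrier_matD[OF A] in simp)
    also have "Y * A ^\<^sub>m n = (Y * R) * A ^\<^sub>m (n + n)"
      unfolding R(3) assoc_mult_mat[OF Y pow_carrier_mat[OF A] R(1)]
        assoc_mult_mat[OF Y R(1) pow_carrier_mat[OF A]] commute_pow[OF A R(1,2)] ..
    also have "Y * R = mat_of_rows n [row (Y * R) 0]"
      using mult_carrier_mat[OF Y R(1)]
      by (intro eq_matI) (auto simp: mat_of_rows_index simp del: index_mult_mat)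
    finally have "row (A ^\<^sub>m n) i = row (mat_of_rows n [row (Y * R) 0] * A ^\<^sub>m (n + n)) 0" .
    moreover have "row (Y * R) 0 \<in> carrier_vec n"
      using carrier_matD[OF R(1)] by (intro carrier_vecI) simp
    ultimately show ?thesis by blast
  qed
  then have "\<exists>w. \<forall>i<n. w i \<in> carrier_vec n \<and>
    row (A ^\<^sub>m n) i = row (mat_of_rows n [w i] * A ^\<^sub>m (n + n)) 0" by (intro choice) blast
  then obtain w where w: "\<And>i. i < n \<Longrightarrow> w i \<in> carrier_vec n"
    "\<And>i. i < n \<Longrightarrow> row (A ^\<^sub>m n) i = row (mat_of_rows n [w i] * A ^\<^sub>m (n + n)) 0" by blast
  define W where "W = mat_of_rows n (map w [0..<n])"
  have W: "W \<in> carrier_mat n n" by (auto simp: W_def intro: carrier_matI)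
  have "A ^\<^sub>m n = W * A ^\<^sub>m (n + n)"
  proof (rule eq_rowI)
    fix i assume "i < dim_row (W * A ^\<^sub>m (n + n))"
    then have i: "i < n" using W by simp
    show "row (A ^\<^sub>m n) i = row (W * A ^\<^sub>m (n + n)) i"
      unfolding w(2)[OF i] using i w(1)[OF i] A W by (intro eq_vecI) (auto simp: W_def)
  qed (use A W in auto)
  then show ?thesis using W by blast
qed

section \<open>Coordinates with respect to an ordered basis\<close>

text \<open>
  Span and independence inside \<open>W\<close> agree with those of the ambient space, and since the list has
  no repetitions, a combination indexed by the set of its members is one indexed by positions, that
  is, a matrix-vector product.
\<close>

lemma ordered_basis_coordinates:
  fixes W :: "'a :: field vec set"
  assumes W: "submodule class_ring W (module_vec TYPE('a) n)" and bs: "ordered_basis n W bs"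
  shows ordered_basis_subset: "set bs \<subseteq> W"
    and ordered_basis_spans: "v \<in> W \<Longrightarrow> \<exists>c \<in> carrier_vec (length bs). v = mat_of_cols n bs *\<^sub>v c"
    and ordered_basis_independent:
      "c \<in> carrier_vec (length bs) \<Longrightarrow> mat_of_cols n bs *\<^sub>v c = 0\<^sub>v n \<Longrightarrow> c = 0\<^sub>v (length bs)"
proof -
  interpret vec_space "TYPE('a)" n .
  have sub: "subspace class_ring W V" using W vec_vs by (simp add: subspace_def)
  interpret WV: vectorspace class_ring "V\<lparr>carrier := W\<rparr>" by (rule subspace_is_vs[OF sub])
  have dist: "distinct bs" and basis: "WV.basis (set bs)"
    using bs by (auto simp: ordered_basis_def)
  show bsW: "set bs \<subseteq> W" using basis by (simp add: WV.basis_def)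
  have WC: "W \<subseteq> carrier_vec n" using W by (auto simp: submodule_def module_vec_simps)
  have carr: "set bs \<subseteq> carrier_vec n" using bsW WC by auto
  have li: "lin_indpt (set bs)" and span: "span (set bs) = W"
    using basis span_li_not_depend[OF bsW W] by (auto simp: WV.basis_def)
  have dims: "\<forall>w\<in>set bs. dim_vec w = n" using carr carrier_vecD by (meson subsetD)
  have lin: "lincomb f (set bs) = mat_of_cols n bs *\<^sub>v vec (length bs) (\<lambda>i. f (bs ! i))" for f
    using lincomb_as_lincomb_list_distinct[OF carr dist]
      lincomb_list_as_mat_mult[OF dims] by simp
  show "\<exists>c \<in> carrier_vec (length bs). v = mat_of_cols n bs *\<^sub>v c" if vW: "v \<in> W"
  proof -
    obtain f where "v = lincomb f (set bs)"
      using finite_in_span[OF finite_set carr, of v] vW span by auto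
    then show ?thesis unfolding lin by auto
  qed
  show "c = 0\<^sub>v (length bs)"
    if c: "c \<in> carrier_vec (length bs)" and zero: "mat_of_cols n bs *\<^sub>v c = 0\<^sub>v n"
  proof (rule ccontr)
    assume "c \<noteq> 0\<^sub>v (length bs)"
    then obtain i where i: "i < length bs" "c $ i \<noteq> 0"
      using c eq_vecI[of c "0\<^sub>v (length bs)"] by auto
    define f where "f v = c $ (THE k. k < length bs \<and> bs ! k = v)" for v
    have f: "f (bs ! k) = c $ k" if "k < length bs" for k
    proof -
      have "(THE k'. k' < length bs \<and> bs ! k' = bs ! k) = k"
        using that dist by (intro the_equality) (auto simp: nth_eq_iff_index_eq)
      then show ?thesis by (simp add: f_def)
    qed
    have "vec (length bs) (\<lambda>k. f (bs ! k)) = c" using c f by (intro eq_vecI) auto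
    then have "lincomb f (set bs) = 0\<^sub>v n" using lin zero by simp
    then have "lin_dep (set bs)"
      using i f by (intro lin_dep_crit[where A = "set bs" and a = f and v = "bs ! i"]) auto
    with li show False by blast
  qed
qed

text \<open>
  From here on the basis enters only through the matrix of its members as rows. This and the next
  two lemmas are what spanning and independence mean for that matrix, applied to all rows of
  another matrix at once, so that the later arguments are identities between matrix products.
\<close>

lemma ordered_basis_mat_coordinates:
  fixes W :: "'a :: field vec set"
  assumes W: "submodule class_ring W (module_vec TYPE('a) n)" and bs: "ordered_basis n W bs"
    and X: "X \<in> carrier_mat m n" and rows: "\<And>i. i < m \<Longrightarrow> row X i \<in> W"
  shows "\<exists>C \<in> carrier_mat m (length bs). X = C * mat_of_rows n bs"
proof -
  have "\<exists>c. \<forall>i<m. c i \<in> carrier_vec (length bs) \<and> row X i = mat_of_cols n bs *\<^sub>v c i"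
    using ordered_basis_spans[OF W bs rows] by (intro choice) blast
  then obtain c where c: "\<And>i. i < m \<Longrightarrow> c i \<in> carrier_vec (length bs)"
    "\<And>i. i < m \<Longrightarrow> row X i = mat_of_cols n bs *\<^sub>v c i" by blast
  define C where "C = mat_of_rows (length bs) (map c [0..<m])"
  have C: "C \<in> carrier_mat m (length bs)" by (auto simp: C_def intro: carrier_matI)
  have "X = C * mat_of_rows n bs"
  proof (rule eq_matI)
    fix i j assume "i < dim_row (C * mat_of_rows n bs)" "j < dim_col (C * mat_of_rows n bs)"
    then have ij: "i < m" "j < n" using C by auto
    have "X $$ (i, j) = row X i $ j" using ij X by simp
    also have "\<dots> = row (mat_of_cols n bs) j \<bullet> c i" using c(2)[OF ij(1)] ij by simp
    also have "\<dots> = c i \<bullet> row (mat_of_cols n bs) j"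
      using c(1)[OF ij(1)] by (intro comm_scalar_prod[of _ "length bs"]) (auto intro: carrier_vecI)
    also have "row (mat_of_cols n bs) j = col (mat_of_rows n bs) j"
      using ij by (simp flip: transpose_mat_of_rows)
    also have "c i = row C i" using ij c(1) by (simp add: C_def)
    finally show "X $$ (i, j) = (C * mat_of_rows n bs) $$ (i, j)" using ij C by simp
  qed (use X C in auto)
  then show ?thesis using C by blast
qed

lemma ordered_basis_mat_cancel:
  fixes W :: "'a :: field vec set"
  assumes W: "submodule class_ring W (module_vec TYPE('a) n)" and bs: "ordered_basis n W bs"
    and X: "X \<in> carrier_mat m (length bs)" and zero: "X * mat_of_rows n bs = 0\<^sub>m m n"
  shows "X = 0\<^sub>m m (length bs)"
proof (rule eq_rowI)
  fix i assume "i < dim_row (0\<^sub>m m (length bs) :: 'a mat)"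
  then have i: "i < m" by simp
  have r: "row X i \<in> carrier_vec (length bs)" using X i by auto
  have "mat_of_cols n bs *\<^sub>v row X i = 0\<^sub>v n"
  proof (rule eq_vecI)
    fix j assume "j < dim_vec (0\<^sub>v n :: 'a vec)"
    then have j: "j < n" by simp
    have "(mat_of_cols n bs *\<^sub>v row X i) $ j = row X i \<bullet> row (mat_of_cols n bs) j"
      using r j by (auto intro!: comm_scalar_prod[of _ "length bs"] carrier_vecI)
    also have "row (mat_of_cols n bs) j = col (mat_of_rows n bs) j"
      using j by (simp flip: transpose_mat_of_rows)
    also have "row X i \<bullet> col (mat_of_rows n bs) j = (X * mat_of_rows n bs) $$ (i, j)"
      using i j X by simp
    finally show "(mat_of_cols n bs *\<^sub>v row X i) $ j = 0\<^sub>v n $ j" using zero i j by simp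
  qed simp
  then show "row X i = row (0\<^sub>m m (length bs)) i"
    using ordered_basis_independent[OF W bs r] i by simp
qed (use X in auto)

lemma ordered_basis_mat_left_unit:
  fixes W :: "'a :: field vec set"
  assumes W: "submodule class_ring W (module_vec TYPE('a) n)" and bs: "ordered_basis n W bs"
    and K: "K \<in> carrier_mat (length bs) (length bs)"
    and unit: "K * mat_of_rows n bs = mat_of_rows n bs"
  shows "K = 1\<^sub>m (length bs)"
proof -
  let ?p = "length bs" and ?P = "mat_of_rows n bs"
  have P: "?P \<in> carrier_mat ?p n" by simp
  have D: "K - 1\<^sub>m ?p \<in> carrier_mat ?p ?p" by (rule minus_carrier_mat) simp
  have "(K - 1\<^sub>m ?p) * ?P = K * ?P - 1\<^sub>m ?p * ?P"
    by (rule minus_mult_distrib_mat[OF K one_carrier_mat P])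
  also have "\<dots> = 0\<^sub>m ?p n" unfolding unit by simp
  finally have zero: "K - 1\<^sub>m ?p = 0\<^sub>m ?p ?p" by (rule ordered_basis_mat_cancel[OF W bs D])
  show ?thesis
  proof (rule eq_matI)
    fix i j assume ij: "i < dim_row (1\<^sub>m ?p :: 'a mat)" "j < dim_col (1\<^sub>m ?p :: 'a mat)"
    then have "(K - 1\<^sub>m ?p) $$ (i, j) = 0" unfolding zero by simp
    then show "K $$ (i, j) = (1\<^sub>m ?p :: 'a mat) $$ (i, j)" using ij K by simp
  qed (use K in auto)
qed

lemma row_mult_eq_vec_mult_mat:
  "X \<in> carrier_mat m k \<Longrightarrow> i < m \<Longrightarrow> row (X * A) i = row X i \<^sub>v* A"
  by (intro eq_vecI) (auto simp: vec_mult_mat_def)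

lemma represents_on_mat_of_rows:
  fixes A :: "'a :: field mat"
  assumes A: "A \<in> carrier_mat n n" and carr: "set bs \<subseteq> carrier_vec n" and M: "represents_on A bs M"
  shows "M \<in> carrier_mat (length bs) (length bs)"
    and "mat_of_rows n bs * A = M * mat_of_rows n bs"
proof -
  show Mc: "M \<in> carrier_mat (length bs) (length bs)" using M by (simp add: represents_on_def)
  have nth: "k < length bs \<Longrightarrow> bs ! k \<in> carrier_vec n" for k using carr by auto
  have nth_dim: "k < length bs \<Longrightarrow> dim_vec (bs ! k) = n" for k using nth[of k] by simp
  show "mat_of_rows n bs * A = M * mat_of_rows n bs"
  proof (rule eq_matI)
    fix i j assume "i < dim_row (M * mat_of_rows n bs)" "j < dim_col (M * mat_of_rows n bs)"
    then have ij: "i < length bs" "j < n" using Mc by auto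
    have "(mat_of_rows n bs * A) $$ (i, j) = (bs ! i \<^sub>v* A) $ j"
      using ij A nth by (simp add: vec_mult_mat_def)
    also have "\<dots> = (\<Sum>k<length bs. (M $$ (i, k) \<cdot>\<^sub>v bs ! k) $ j)"
    proof -
      have "bs ! i \<^sub>v* A = finsum_vec TYPE('a) n (\<lambda>k. M $$ (i, k) \<cdot>\<^sub>v bs ! k) {..<length bs}"
        using M ij carrier_matD(1)[OF A] by (simp only: represents_on_def)
      moreover have "finsum_vec TYPE('a) n (\<lambda>k. M $$ (i, k) \<cdot>\<^sub>v bs ! k) {..<length bs} $ j
        = (\<Sum>k<length bs. (M $$ (i, k) \<cdot>\<^sub>v bs ! k) $ j)"
        using ij nth by (intro index_finsum_vec) auto
      ultimately show ?thesis by simp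
    qed
    also have "\<dots> = (\<Sum>k<length bs. M $$ (i, k) * bs ! k $ j)"
      using ij by (intro sum.cong) (simp_all add: nth_dim)
    also have "\<dots> = (M * mat_of_rows n bs) $$ (i, j)"
      using ij Mc by (simp add: scalar_prod_def mat_of_rows_index atLeast0LessThan)
    finally show "(mat_of_rows n bs * A) $$ (i, j) = (M * mat_of_rows n bs) $$ (i, j)" .
  qed (use A Mc in auto)
qed

section \<open>Nil space and invertible space as row spaces\<close>

lemma vec_mult_mat_linear:
  fixes A :: "'a :: field mat"
  assumes A: "A \<in> carrier_mat n m"
  shows "u \<in> carrier_vec n \<Longrightarrow> v \<in> carrier_vec n \<Longrightarrow> (u + v) \<^sub>v* A = u \<^sub>v* A + v \<^sub>v* A"
    and "v \<in> carrier_vec n \<Longrightarrow> (c \<cdot>\<^sub>v v) \<^sub>v* A = c \<cdot>\<^sub>v (v \<^sub>v* A)"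
    and "0\<^sub>v n \<^sub>v* A = 0\<^sub>v m"
proof -
  have col: "col A j \<in> carrier_vec n" for j using A by auto
  show "u \<in> carrier_vec n \<Longrightarrow> v \<in> carrier_vec n \<Longrightarrow> (u + v) \<^sub>v* A = u \<^sub>v* A + v \<^sub>v* A"
    by (intro eq_vecI) (auto simp: vec_mult_mat_def add_scalar_prod_distrib[OF _ _ col])
  show "v \<in> carrier_vec n \<Longrightarrow> (c \<cdot>\<^sub>v v) \<^sub>v* A = c \<cdot>\<^sub>v (v \<^sub>v* A)"
    using col by (intro eq_vecI) (auto simp: vec_mult_mat_def)
  show "0\<^sub>v n \<^sub>v* A = 0\<^sub>v m"
    using A col by (intro eq_vecI) (auto simp: vec_mult_mat_def)
qed

lemma vec_mult_mat_carrier [simp]: "v \<^sub>v* A \<in> carrier_vec (dim_col A)"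
  by (simp add: vec_mult_mat_def)

lemma nil_space_submodule:
  fixes A :: "'a :: field mat"
  assumes A: "A \<in> carrier_mat n n"
  shows "submodule class_ring (nil_space A) (module_vec TYPE('a) n)"
  using vec_mult_mat_linear[OF pow_carrier_mat[OF A, of n]] vec_module[of n] carrier_matD[OF A]
  by (auto simp: submodule_def module_vec_simps nil_space_def)

lemma inv_space_submodule:
  fixes A :: "'a :: field mat"
  assumes A: "A \<in> carrier_mat n n"
  shows "submodule class_ring (inv_space A) (module_vec TYPE('a) n)"
proof -
  let ?N = "A ^\<^sub>m n"
  note lin = vec_mult_mat_linear[OF pow_carrier_mat[OF A, of n]]
  have inv: "inv_space A = (\<lambda>v. v \<^sub>v* ?N) ` carrier_vec n"
    using carrier_matD[OF A] by (auto simp: inv_space_def)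
  have "u \<^sub>v* ?N + v \<^sub>v* ?N \<in> inv_space A"
    if "u \<in> carrier_vec n" "v \<in> carrier_vec n" for u v
    unfolding inv using that by (intro image_eqI[of _ _ "u + v"]) (simp_all add: lin(1))
  moreover have "c \<cdot>\<^sub>v (v \<^sub>v* ?N) \<in> inv_space A" if "v \<in> carrier_vec n" for c v
    unfolding inv using that by (intro image_eqI[of _ _ "c \<cdot>\<^sub>v v"]) (simp_all add: lin(2))
  moreover have "0\<^sub>v n \<in> inv_space A"
    unfolding inv by (intro image_eqI[of _ _ "0\<^sub>v n"]) (simp_all add: lin(3))
  moreover have "inv_space A \<subseteq> carrier_vec n"
    using vec_mult_mat_carrier[of _ ?N] carrier_matD[OF pow_carrier_mat[OF A, of n]]
    by (auto simp: inv)
  ultimately show ?thesis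
    using vec_module[of n] by (auto simp: submodule_def module_vec_simps inv)
qed

lemma rows_in_nil_space_iff:
  fixes A :: "'a :: field mat"
  assumes A: "A \<in> carrier_mat n n" and X: "X \<in> carrier_mat m n"
  shows "(\<forall>i<m. row X i \<in> nil_space A) \<longleftrightarrow> X * A ^\<^sub>m n = 0\<^sub>m m n"
proof -
  note N = carrier_matD[OF pow_carrier_mat[OF A, of n]]
  have "(\<forall>i<m. row X i \<in> nil_space A) \<longleftrightarrow> (\<forall>i<m. row (X * A ^\<^sub>m n) i = 0\<^sub>v n)"
    using X carrier_matD[OF A] by (auto simp: nil_space_def row_mult_eq_vec_mult_mat[OF X])
  also have "\<dots> \<longleftrightarrow> X * A ^\<^sub>m n = 0\<^sub>m m n"
  proof
    assume "\<forall>i<m. row (X * A ^\<^sub>m n) i = 0\<^sub>v n"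
    then show "X * A ^\<^sub>m n = 0\<^sub>m m n" using X N by (intro eq_rowI) auto
  qed simp
  finally show ?thesis .
qed

lemma rows_in_inv_space_iff:
  fixes A :: "'a :: field mat"
  assumes A: "A \<in> carrier_mat n n" and X: "X \<in> carrier_mat m n"
  shows "(\<forall>i<m. row X i \<in> inv_space A) \<longleftrightarrow> (\<exists>Z \<in> carrier_mat m n. X = Z * A ^\<^sub>m n)"
proof
  note N = carrier_matD[OF pow_carrier_mat[OF A, of n]]
  assume "\<forall>i<m. row X i \<in> inv_space A"
  then have "\<exists>z. \<forall>i<m. z i \<in> carrier_vec n \<and> row X i = z i \<^sub>v* A ^\<^sub>m n"
    using carrier_matD[OF A] by (intro choice) (auto simp: inv_space_def)
  then obtain z where z: "\<And>i. i < m \<Longrightarrow> z i \<in> carrier_vec n"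
    "\<And>i. i < m \<Longrightarrow> row X i = z i \<^sub>v* A ^\<^sub>m n" by blast
  define Z where "Z = mat_of_rows n (map z [0..<m])"
  have Z: "Z \<in> carrier_mat m n" by (auto simp: Z_def intro: carrier_matI)
  have "X = Z * A ^\<^sub>m n"
  proof (rule eq_rowI)
    fix i assume "i < dim_row (Z * A ^\<^sub>m n)"
    then have i: "i < m" using Z by simp
    have "row Z i = z i" using i z(1) by (simp add: Z_def)
    then show "row X i = row (Z * A ^\<^sub>m n) i"
      using z(2)[OF i] row_mult_eq_vec_mult_mat[OF Z i] by simp
  qed (use X Z N in auto)
  then show "\<exists>Z \<in> carrier_mat m n. X = Z * A ^\<^sub>m n" using Z by blast
next
  assume "\<exists>Z \<in> carrier_mat m n. X = Z * A ^\<^sub>m n"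
  then obtain Z where Z: "Z \<in> carrier_mat m n" "X = Z * A ^\<^sub>m n" by blast
  show "\<forall>i<m. row X i \<in> inv_space A"
    using Z carrier_matD[OF A] by (auto simp: inv_space_def row_mult_eq_vec_mult_mat[OF Z(1)])
qed

text \<open>
  The matrices \<open>Q1\<close>, \<open>Q2\<close> hold the coordinates of the components of the identity matrix in the two
  summands: with \<open>N = A\<^sup>n = W N\<^sup>2\<close> the identity is \<open>(1 - W N) + W N\<close>, where the first summand is
  annihilated by \<open>N\<close>. A row in one summand has coordinates zero in the other, because the sum is
  direct; applied to the basis rows themselves this yields the products \<open>P1 Q1\<close> and \<open>P2 Q2\<close>.
\<close>

lemma fitting_coordinates:
  fixes A :: "'a :: field mat"
  assumes A: "A \<in> carrier_mat n n"
    and bs: "ordered_basis n (nil_space A) bs" and cs: "ordered_basis n (inv_space A) cs"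
  defines "P1 \<equiv> mat_of_rows n bs" and "P2 \<equiv> mat_of_rows n cs"
  obtains Q1 Q2 where
    "Q1 \<in> carrier_mat n (length bs)" "Q2 \<in> carrier_mat n (length cs)"
    "Q1 * P1 + Q2 * P2 = 1\<^sub>m n"
    "P1 * Q1 = 1\<^sub>m (length bs)" "P2 * Q2 = 1\<^sub>m (length cs)"
    "\<And>m X. X \<in> carrier_mat m n \<Longrightarrow> X * A ^\<^sub>m n = 0\<^sub>m m n \<Longrightarrow> X * Q2 = 0\<^sub>m m (length cs)"
    "\<And>m Y. Y \<in> carrier_mat m n \<Longrightarrow> Y * A ^\<^sub>m n * Q1 = 0\<^sub>m m (length bs)"
    "P1 * A ^\<^sub>m n = 0\<^sub>m (length bs) n"
    "\<exists>Z \<in> carrier_mat (length cs) n. P2 = Z * A ^\<^sub>m n"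
proof -
  let ?p = "length bs" and ?q = "length cs"
  define N where "N = A ^\<^sub>m n"
  have N: "N \<in> carrier_mat n n" using A by (simp add: N_def)
  note sub1 = nil_space_submodule[OF A] and sub2 = inv_space_submodule[OF A]
  have P1: "P1 \<in> carrier_mat ?p n" and P2: "P2 \<in> carrier_mat ?q n"
    by (auto simp: P1_def P2_def intro: carrier_matI)
  have in_nil: "set bs \<subseteq> nil_space A" by (rule ordered_basis_subset[OF sub1 bs])
  have in_inv: "set cs \<subseteq> inv_space A" by (rule ordered_basis_subset[OF sub2 cs])
  have nil_carr: "nil_space A \<subseteq> carrier_vec n" and inv_carr: "inv_space A \<subseteq> carrier_vec n"
    using sub1 sub2 by (simp_all add: submodule_def module_vec_simps)
  have "row P1 i \<in> nil_space A" if "i < ?p" for i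
  proof -
    have "bs ! i \<in> nil_space A" using in_nil that by auto
    then show ?thesis using that nil_carr by (auto simp: P1_def)
  qed
  then have P1N: "P1 * N = 0\<^sub>m ?p n" using rows_in_nil_space_iff[OF A P1] by (simp add: N_def)
  have "row P2 i \<in> inv_space A" if "i < ?q" for i
  proof -
    have "cs ! i \<in> inv_space A" using in_inv that by auto
    then show ?thesis using that inv_carr by (auto simp: P2_def)
  qed
  then have "\<exists>Z \<in> carrier_mat ?q n. P2 = Z * N"
    using rows_in_inv_space_iff[OF A P2] by (simp add: N_def)
  then obtain Z where Z: "Z \<in> carrier_mat ?q n" and P2Z: "P2 = Z * N" by blast
  have NN: "A ^\<^sub>m (n + n) = N * N" using pow_mat_add[OF A] by (simp add: N_def)
  \<comment> \<open>This is the directness of the sum: the rows of \<open>V\<close> lie in both summands.\<close>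
  have direct: "V = 0\<^sub>m m n" if V: "V * N = 0\<^sub>m m n" and VT: "V = T * N" and T: "T \<in> carrier_mat m n"
    for V T m
  proof -
    have "T * (N * N) = 0\<^sub>m m n" using V unfolding VT assoc_mult_mat[OF T N N] .
    then show ?thesis using fitting_kernel[OF A T] unfolding VT N_def[symmetric] NN by blast
  qed
  obtain W where W: "W \<in> carrier_mat n n" and NW: "N = W * (N * N)"
    using fitting_image[OF A] unfolding NN N_def[symmetric] by blast
  define F where "F = W * N"
  define E where "E = 1\<^sub>m n - F"
  have F: "F \<in> carrier_mat n n" and E: "E \<in> carrier_mat n n"
    using W N by (auto simp: F_def E_def)
  have EF: "E + F = 1\<^sub>m n" using F by (intro eq_matI) (auto simp: E_def)
  have FN: "F * N = N" unfolding F_def assoc_mult_mat[OF W N N] by (rule NW[symmetric])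
  have "E * N = 1\<^sub>m n * N - F * N"
    unfolding E_def by (rule minus_mult_distrib_mat[OF one_carrier_mat F N])
  then have EN: "E * N = 0\<^sub>m n n" using FN N by (auto intro!: eq_matI)
  obtain Q1 where Q1: "Q1 \<in> carrier_mat n ?p" and EQ: "E = Q1 * P1"
  proof -
    have "\<forall>i<n. row E i \<in> nil_space A" using rows_in_nil_space_iff[OF A E] EN by (simp add: N_def)
    then show thesis
      using ordered_basis_mat_coordinates[OF sub1 bs E] that unfolding P1_def by blast
  qed
  obtain Q2 where Q2: "Q2 \<in> carrier_mat n ?q" and FQ: "F = Q2 * P2"
  proof -
    have "\<exists>Z \<in> carrier_mat n n. F = Z * N" using W F_def by blast
    then have "\<forall>i<n. row F i \<in> inv_space A" using rows_in_inv_space_iff[OF A F] by (simp add: N_def)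
    then show thesis
      using ordered_basis_mat_coordinates[OF sub2 cs F] that unfolding P2_def by blast
  qed
  have sum: "Q1 * P1 + Q2 * P2 = 1\<^sub>m n" using EF EQ FQ by simp
  note dims = carrier_matD[OF N] carrier_matD[OF P1] carrier_matD[OF P2] carrier_matD[OF Q1]
    carrier_matD[OF Q2] carrier_matD[OF Z]
  have split: "X = (X * Q1) * P1 + (X * Q2) * P2" if X: "X \<in> carrier_mat m n" for X m
  proof -
    have "X = X * (Q1 * P1 + Q2 * P2)" using X by (simp add: sum)
    also have "\<dots> = (X * Q1) * P1 + (X * Q2) * P2"
      using dims carrier_matD[OF X] by (simp add: mat_ring_simps)
    finally show ?thesis .
  qed
  \<comment> \<open>For rows \<open>X\<close> of the nil space, \<open>(X Q2) P2\<close> is the difference of two nil rows, so it lies in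
    both summands. Then \<open>P2\<close> is cancelled. The next step is the mirror image.\<close>
  have nilQ2: "X * Q2 = 0\<^sub>m m ?q" if X: "X \<in> carrier_mat m n" and XN: "X * N = 0\<^sub>m m n" for X m
  proof -
    note d = dims carrier_matD[OF X]
    define U where "U = X * Q2"
    have U: "U \<in> carrier_mat m ?q" using X Q2 by (simp add: U_def)
    have "X * N = ((X * Q1) * P1 + U * P2) * N" using split[OF X] by (simp add: U_def)
    also have "\<dots> = (X * Q1) * (P1 * N) + (U * P2) * N"
      using d carrier_matD[OF U] by (simp add: mat_ring_simps)
    also have "\<dots> = (U * P2) * N"
      unfolding P1N using X Q1 U P2 N by (auto intro!: eq_matI)
    finally have UN: "(U * P2) * N = 0\<^sub>m m n" using XN by simp
    have "U * P2 = (U * Z) * N"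
      unfolding P2Z using d carrier_matD[OF U] by (simp add: mat_ring_simps)
    from direct[OF UN this] have "U * P2 = 0\<^sub>m m n" using U Z by simp
    then show ?thesis using ordered_basis_mat_cancel[OF sub2 cs U] by (simp add: P2_def U_def)
  qed
  have invQ1: "Y * N * Q1 = 0\<^sub>m m ?p" if Y: "Y \<in> carrier_mat m n" for Y m
  proof -
    note d = dims carrier_matD[OF Y]
    define U where "U = Y * N * Q1"
    define T where "T = Y - Y * N * Q2 * Z"
    have YN: "Y * N \<in> carrier_mat m n" using Y N by simp
    have U: "U \<in> carrier_mat m ?p" using Y N Q1 by (auto simp: U_def)
    have S: "Y * N * Q2 * Z \<in> carrier_mat m n" using Y N Q2 Z by auto
    have T: "T \<in> carrier_mat m n" unfolding T_def by (rule minus_carrier_mat[OF S])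
    have S2: "U * P1 \<in> carrier_mat m n" "(Y * N * Q2) * P2 \<in> carrier_mat m n"
      using U P1 P2 Y N Q2 by auto
    have "T * N = Y * N - (Y * N * Q2 * Z) * N"
      unfolding T_def by (rule minus_mult_distrib_mat[OF Y S N])
    also have "(Y * N * Q2 * Z) * N = (Y * N * Q2) * P2"
      unfolding P2Z using d by (simp add: mat_ring_simps)
    also have "Y * N - (Y * N * Q2) * P2 = U * P1"
    proof -
      define L where "L = Y * N * Q2 * P2"
      have L: "L \<in> carrier_mat m n" unfolding L_def by (rule S2(2))
      have YN_eq: "Y * N = U * P1 + L" unfolding U_def L_def by (rule split[OF YN])
      have "K + L - L = K" if "K \<in> carrier_mat m n" for K :: "'a mat"
        using that L by (intro eq_matI) auto
      then have "Y * N - L = U * P1" unfolding YN_eq using S2(1) by blast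
      then show ?thesis by (simp only: L_def)
    qed
    finally have UT: "U * P1 = T * N" ..
    have "(U * P1) * N = U * (P1 * N)" by (rule assoc_mult_mat[OF U P1 N])
    then have "(U * P1) * N = 0\<^sub>m m n" unfolding P1N using U by simp
    from direct[OF this UT T] have "U * P1 = 0\<^sub>m m n" .
    then show ?thesis using ordered_basis_mat_cancel[OF sub1 bs U] by (simp add: P1_def U_def)
  qed
  \<comment> \<open>\<open>P1\<close> has no component in the other summand, so \<open>(P1 Q1) P1 = P1\<close> and \<open>P1\<close> can be cancelled.\<close>
  have PQ1: "P1 * Q1 = 1\<^sub>m ?p"
  proof -
    have c: "P1 * Q1 \<in> carrier_mat ?p ?p" using P1 Q1 by simp
    have "P1 = (P1 * Q1) * P1 + (P1 * Q2) * P2" by (rule split[OF P1])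
    also have "\<dots> = (P1 * Q1) * P1"
      unfolding nilQ2[OF P1 P1N] using c P1 P2 by simp
    finally have "(P1 * Q1) * P1 = P1" ..
    from ordered_basis_mat_left_unit[OF sub1 bs c[unfolded P1_def] this[unfolded P1_def]] show ?thesis
      unfolding P1_def .
  qed
  have PQ2: "P2 * Q2 = 1\<^sub>m ?q"
  proof -
    have c: "P2 * Q2 \<in> carrier_mat ?q ?q" using P2 Q2 by simp
    have zero: "P2 * Q1 = 0\<^sub>m ?q ?p" unfolding P2Z by (rule invQ1[OF Z])
    have "P2 = (P2 * Q1) * P1 + (P2 * Q2) * P2" by (rule split[OF P2])
    also have "\<dots> = (P2 * Q2) * P2" unfolding zero using c P1 P2 by simp
    finally have "(P2 * Q2) * P2 = P2" ..
    from ordered_basis_mat_left_unit[OF sub2 cs c[unfolded P2_def] this[unfolded P2_def]] show ?thesis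
      unfolding P2_def .
  qed
  show thesis
    using Z P2Z unfolding N_def
    by (intro that[OF Q1 Q2 sum PQ1 PQ2 nilQ2[unfolded N_def] invQ1[unfolded N_def]
          P1N[unfolded N_def]]) blast+
qed

section \<open>The spaces of twisted commutants\<close>

lemma C_set_iff:
  assumes A: "A \<in> carrier_mat n n"
  shows "B \<in> C_set A l \<longleftrightarrow> B \<in> carrier_mat n n \<and> A * B = l \<cdot>\<^sub>m (B * A)"
proof -
  have "A * B = l \<cdot>\<^sub>m (B * A)"
    if B: "B \<in> carrier_mat n n" and zero: "A * B - l \<cdot>\<^sub>m (B * A) = 0\<^sub>m n n"
  proof (rule eq_matI)
    fix i j assume "i < dim_row (l \<cdot>\<^sub>m (B * A))" "j < dim_col (l \<cdot>\<^sub>m (B * A))"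
    then have ij: "i < n" "j < n" using A B by auto
    have "(A * B - l \<cdot>\<^sub>m (B * A)) $$ (i, j) = 0" unfolding zero using ij by simp
    then show "(A * B) $$ (i, j) = (l \<cdot>\<^sub>m (B * A)) $$ (i, j)"
      using ij A B by (simp del: index_mult_mat(1))
  qed (use A B in auto)
  moreover have "l \<cdot>\<^sub>m (B * A) - l \<cdot>\<^sub>m (B * A) = 0\<^sub>m n n" if "B \<in> carrier_mat n n"
    using A that by (intro eq_matI) (simp_all del: index_mult_mat(1))
  ultimately show ?thesis using carrier_matD[OF A] by (auto simp: C_set_def)
qed

lemma C_space_simps [simp]:
  "carrier (C_space A l) = C_set A l"
  "add (C_space A l) = (+)"
  "smult (C_space A l) = (\<cdot>\<^sub>m)"
  by (simp_all add: C_space_def module_mat_simps)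

lemma C_set_submodule:
  fixes A :: "'a :: field mat"
  assumes A: "A \<in> carrier_mat n n"
  shows "submodule class_ring (C_set A l) (module_mat TYPE('a) n n)"
proof -
  have "X + Y \<in> C_set A l" if X: "X \<in> C_set A l" and Y: "Y \<in> C_set A l" for X Y
  proof -
    from X Y have c: "X \<in> carrier_mat n n" "Y \<in> carrier_mat n n"
      and e: "A * X = l \<cdot>\<^sub>m (X * A)" "A * Y = l \<cdot>\<^sub>m (Y * A)" by (auto simp: C_set_iff[OF A])
    have "A * (X + Y) = l \<cdot>\<^sub>m ((X + Y) * A)"
      using A c e add_smult_distrib_left_mat[of "X * A" n n "Y * A" l] by (simp add: mat_ring_simps)
    then show ?thesis using c by (simp add: C_set_iff[OF A])
  qed
  moreover have "c \<cdot>\<^sub>m X \<in> C_set A l" if X: "X \<in> C_set A l" for X c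
  proof -
    from X have X: "X \<in> carrier_mat n n" "A * X = l \<cdot>\<^sub>m (X * A)" by (auto simp: C_set_iff[OF A])
    have "A * (c \<cdot>\<^sub>m X) = c \<cdot>\<^sub>m (l \<cdot>\<^sub>m (X * A))"
      using A X by (simp add: mat_ring_simps)
    also have "\<dots> = l \<cdot>\<^sub>m (c \<cdot>\<^sub>m (X * A))"
      by (rule eq_matI) (simp_all add: mult.left_commute del: index_mult_mat(1))
    also have "\<dots> = l \<cdot>\<^sub>m ((c \<cdot>\<^sub>m X) * A)" using A X by (simp add: mat_ring_simps)
    finally show ?thesis using X by (simp add: C_set_iff[OF A])
  qed
  moreover have "l \<cdot>\<^sub>m (0\<^sub>m n n :: 'a mat) = 0\<^sub>m n n" by (intro eq_matI) auto
  then have "0\<^sub>m n n \<in> C_set A l" using A by (simp add: C_set_iff[OF A])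
  moreover have "C_set A l \<subseteq> carrier_mat n n" by (auto simp: C_set_iff[OF A])
  moreover have "module class_ring (module_mat TYPE('a) n n)"
    using matrix_vs[of n n] by (auto simp: vectorspace_def)
  ultimately show ?thesis by (simp add: submodule_def module_mat_simps)
qed

lemma C_space_vectorspace:
  fixes A :: "'a :: field mat"
  assumes A: "A \<in> carrier_mat n n"
  shows "vectorspace class_ring (C_space A l)"
proof -
  have "subspace class_ring (C_set A l) (module_mat TYPE('a) n n)"
    using C_set_submodule[OF A] matrix_vs by (intro subspace.intro)
  then show ?thesis
    unfolding C_space_def carrier_matD(1)[OF A] by (rule vectorspace.subspace_is_vs[OF matrix_vs])
qed

text \<open>
  Moving \<open>M\<close> through \<open>P\<close> turns it into \<open>A\<close>, which passes \<open>B\<close> at the cost of \<open>l\<close> and turns back into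
  \<open>M\<close> at \<open>Q\<close>. The hypotheses are symmetric under exchanging \<open>(A, P)\<close> with \<open>(M, Q)\<close>, so this one statement serves
  both for passing from \<open>A\<close> to a diagonal block and for passing back.
\<close>

lemma C_set_transfer:
  fixes A M P Q :: "'a :: field mat"
  assumes A: "A \<in> carrier_mat n n" and M: "M \<in> carrier_mat p p"
    and P: "P \<in> carrier_mat p n" and Q: "Q \<in> carrier_mat n p"
    and PA: "P * A = M * P" and AQ: "A * Q = Q * M" and B: "B \<in> C_set A l"
  shows "P * B * Q \<in> C_set M l"
proof -
  from B have B: "B \<in> carrier_mat n n" and eq: "A * B = l \<cdot>\<^sub>m (B * A)" by (auto simp: C_set_iff[OF A])
  note dims = carrier_matD[OF A] carrier_matD[OF M] carrier_matD[OF P] carrier_matD[OF Q]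
    carrier_matD[OF B]
  have "M * (P * B * Q) = (M * P) * (B * Q)" using dims by (simp add: mat_ring_simps)
  also have "\<dots> = P * (A * B) * Q" unfolding PA[symmetric] using dims by (simp add: mat_ring_simps)
  also have "\<dots> = l \<cdot>\<^sub>m (P * B * (A * Q))" unfolding eq using dims by (simp add: mat_ring_simps)
  also have "\<dots> = l \<cdot>\<^sub>m ((P * B * Q) * M)" unfolding AQ using dims by (simp add: mat_ring_simps)
  finally show ?thesis using P Q B by (auto simp: C_set_iff[OF M])
qed

lemma zero_smult_cancel:
  fixes X :: "'a :: field mat"
  assumes "c \<noteq> 0" and X: "X \<in> carrier_mat m k" and zero: "c \<cdot>\<^sub>m X = 0\<^sub>m m k"
  shows "X = 0\<^sub>m m k"
proof (rule eq_matI)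
  fix i j assume ij: "i < dim_row (0\<^sub>m m k :: 'a mat)" "j < dim_col (0\<^sub>m m k :: 'a mat)"
  then have "(c \<cdot>\<^sub>m X) $$ (i, j) = 0" unfolding zero by simp
  then show "X $$ (i, j) = (0\<^sub>m m k :: 'a mat) $$ (i, j)" using assms(1) ij X by simp
qed (use X in auto)

theorem theorem2p2:
  fixes A A_nil A_inv :: "'a :: field mat" and l :: 'a and n :: nat
  assumes "A \<in> carrier_mat n n"
    and "l \<noteq> 0"
    and "is_nil_part A A_nil"
    and "is_inv_part A A_inv"
  shows "vs_isomorphic class_ring (C_space A l)
           (direct_sum (C_space A_nil l) (C_space A_inv l))"
proof -
  note A = assms(1)
  obtain bs where bs: "ordered_basis n (nil_space A) bs" and rep1: "represents_on A bs A_nil"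
    using assms(3) carrier_matD[OF A] by (auto simp: is_nil_part_def restriction_matrix_def)
  obtain cs where cs: "ordered_basis n (inv_space A) cs" and rep2: "represents_on A cs A_inv"
    using assms(4) carrier_matD[OF A] by (auto simp: is_inv_part_def restriction_matrix_def)
  let ?p = "length bs" and ?q = "length cs"
  define P1 where "P1 = mat_of_rows n bs"
  define P2 where "P2 = mat_of_rows n cs"
  have P1: "P1 \<in> carrier_mat ?p n" and P2: "P2 \<in> carrier_mat ?q n"
    by (auto simp: P1_def P2_def intro: carrier_matI)
  have "set bs \<subseteq> carrier_vec n" and "set cs \<subseteq> carrier_vec n"
    using ordered_basis_subset[OF nil_space_submodule[OF A] bs] nil_space_submodule[OF A]
      ordered_basis_subset[OF inv_space_submodule[OF A] cs] inv_space_submodule[OF A]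
    by (auto simp: submodule_def module_vec_simps)
  then have M1: "A_nil \<in> carrier_mat ?p ?p" and PA1: "P1 * A = A_nil * P1"
    and M2: "A_inv \<in> carrier_mat ?q ?q" and PA2: "P2 * A = A_inv * P2"
    using represents_on_mat_of_rows[OF A _ rep1] represents_on_mat_of_rows[OF A _ rep2]
    by (simp_all add: P1_def P2_def)
  obtain Q1 Q2 where Q1: "Q1 \<in> carrier_mat n ?p" and Q2: "Q2 \<in> carrier_mat n ?q"
    and sum: "Q1 * P1 + Q2 * P2 = 1\<^sub>m n"
    and PQ1: "P1 * Q1 = 1\<^sub>m ?p" and PQ2: "P2 * Q2 = 1\<^sub>m ?q"
    and nilQ2: "\<And>m X. X \<in> carrier_mat m n \<Longrightarrow> X * A ^\<^sub>m n = 0\<^sub>m m n \<Longrightarrow> X * Q2 = 0\<^sub>m m ?q"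
    and invQ1: "\<And>m Y. Y \<in> carrier_mat m n \<Longrightarrow> Y * A ^\<^sub>m n * Q1 = 0\<^sub>m m ?p"
    and P1N: "P1 * A ^\<^sub>m n = 0\<^sub>m ?p n"
    and "\<exists>Z \<in> carrier_mat ?q n. P2 = Z * A ^\<^sub>m n"
    using fitting_coordinates[OF A bs cs] unfolding P1_def P2_def by blast
  then obtain Z where Z: "Z \<in> carrier_mat ?q n" and P2Z: "P2 = Z * A ^\<^sub>m n" by blast
  have N: "A ^\<^sub>m n \<in> carrier_mat n n" using A by simp
  have PQ12: "P1 * Q2 = 0\<^sub>m ?p ?q" by (rule nilQ2[OF P1 P1N])
  have PQ21: "P2 * Q1 = 0\<^sub>m ?q ?p" unfolding P2Z by (rule invQ1[OF Z])
  note dims = carrier_matD[OF A] carrier_matD[OF P1] carrier_matD[OF P2] carrier_matD[OF Q1]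
    carrier_matD[OF Q2] carrier_matD[OF Z] carrier_matD[OF M1] carrier_matD[OF M2]
    carrier_matD[OF N]
  have one: "X = Q1 * (P1 * X) + Q2 * (P2 * X)" if X: "X \<in> carrier_mat n m" for X m
  proof -
    have "X = (Q1 * P1 + Q2 * P2) * X" using X by (simp add: sum)
    then show ?thesis using dims carrier_matD[OF X] by (simp add: mat_ring_simps)
  qed
  have AQ1: "A * Q1 = Q1 * A_nil"
  proof -
    have c: "A * Q1 \<in> carrier_mat n ?p" using A Q1 by simp
    have "P1 * (A * Q1) = A_nil * (P1 * Q1)" "P2 * (A * Q1) = A_inv * (P2 * Q1)"
      using dims PA1 PA2 by (simp_all flip: mult_assoc_dim)
    then show ?thesis using one[OF c] M1 M2 Q1 Q2 by (simp add: PQ1 PQ21)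
  qed
  have AQ2: "A * Q2 = Q2 * A_inv"
  proof -
    have c: "A * Q2 \<in> carrier_mat n ?q" using A Q2 by simp
    have "P1 * (A * Q2) = A_nil * (P1 * Q2)" "P2 * (A * Q2) = A_inv * (P2 * Q2)"
      using dims PA1 PA2 by (simp_all flip: mult_assoc_dim)
    then show ?thesis using one[OF c] M1 M2 Q1 Q2 by (simp add: PQ2 PQ12)
  qed
  \<comment> \<open>The nil space and the invertible space of \<open>A\<close> are invariant under \<open>B\<close>; here \<open>l \<noteq> 0\<close> enters.\<close>
  have off: "P1 * B * Q2 = 0\<^sub>m ?p ?q" "P2 * B * Q1 = 0\<^sub>m ?q ?p" if "B \<in> C_set A l" for B
  proof -
    from that have B: "B \<in> carrier_mat n n" and eq: "A * B = l \<cdot>\<^sub>m (B * A)"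
      by (auto simp: C_set_iff[OF A])
    note d = dims carrier_matD[OF B]
    have pow: "A ^\<^sub>m n * B = l ^ n \<cdot>\<^sub>m (B * A ^\<^sub>m n)" by (rule twisted_commute_pow[OF A B eq])
    have PB: "P1 * B \<in> carrier_mat ?p n" using P1 B by simp
    have "l ^ n \<cdot>\<^sub>m (P1 * B * A ^\<^sub>m n) = P1 * (A ^\<^sub>m n * B)"
      unfolding pow using d by (simp add: mat_ring_simps)
    also have "\<dots> = (P1 * A ^\<^sub>m n) * B" by (rule assoc_mult_mat[OF P1 N B, symmetric])
    also have "\<dots> = 0\<^sub>m ?p n" unfolding P1N using B by simp
    finally have "P1 * B * A ^\<^sub>m n = 0\<^sub>m ?p n"
      using zero_smult_cancel[of "l ^ n"] mult_carrier_mat[OF PB N] assms(2) by simp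
    then show "P1 * B * Q2 = 0\<^sub>m ?p ?q" by (rule nilQ2[OF PB])
    have ZB: "l ^ n \<cdot>\<^sub>m (Z * B) \<in> carrier_mat ?q n" using Z B by simp
    have "P2 * B = Z * (A ^\<^sub>m n * B)" unfolding P2Z by (rule assoc_mult_mat[OF Z N B])
    also have "\<dots> = (l ^ n \<cdot>\<^sub>m (Z * B)) * A ^\<^sub>m n"
      unfolding pow using d by (simp add: mat_ring_simps)
    finally show "P2 * B * Q1 = 0\<^sub>m ?q ?p" using invQ1[OF ZB] by simp
  qed
  let ?D = "direct_sum (C_space A_nil l) (C_space A_inv l)"
  \<comment> \<open>\<open>T\<close> takes the diagonal blocks, and \<open>S\<close> assembles a matrix from them.\<close>
  define T where "T B = (P1 * B * Q1, P2 * B * Q2)" for B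
  define S where "S = (\<lambda>(X, Y). Q1 * X * P1 + Q2 * Y * P2)"
  have T_in: "T B \<in> C_set A_nil l \<times> C_set A_inv l" if "B \<in> C_set A l" for B
    using C_set_transfer[OF A M1 P1 Q1 PA1 AQ1 that] C_set_transfer[OF A M2 P2 Q2 PA2 AQ2 that]
    by (simp add: T_def)
  have S_in: "S XY \<in> C_set A l" if mem: "XY \<in> C_set A_nil l \<times> C_set A_inv l" for XY
  proof -
    obtain X Y where XY: "XY = (X, Y)" "X \<in> C_set A_nil l" "Y \<in> C_set A_inv l" using mem by auto
    have "Q1 * X * P1 \<in> C_set A l" "Q2 * Y * P2 \<in> C_set A l"
      using C_set_transfer[OF M1 A Q1 P1 AQ1[symmetric] PA1[symmetric] XY(2)]
        C_set_transfer[OF M2 A Q2 P2 AQ2[symmetric] PA2[symmetric] XY(3)] .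
    then show ?thesis
      using C_set_submodule[OF A, of l] by (simp add: S_def XY(1) submodule_def module_mat_simps)
  qed
  have ST: "S (T B) = B" if "B \<in> C_set A l" for B
  proof -
    have B: "B \<in> carrier_mat n n" using that by (auto simp: C_set_iff[OF A])
    note d = dims carrier_matD[OF B]
    have row: "P * B = (P * B * Q1) * P1 + (P * B * Q2) * P2" if P: "P \<in> carrier_mat m n" for P m
    proof -
      have "P * B = (P * B) * (Q1 * P1 + Q2 * P2)" using P B by (simp add: sum)
      also have "\<dots> = (P * B * Q1) * P1 + (P * B * Q2) * P2"
        using d carrier_matD[OF P] by (simp add: mat_ring_simps)
      finally show ?thesis .
    qed
    have carr: "(P1 * B * Q1) * P1 \<in> carrier_mat ?p n" "(P2 * B * Q2) * P2 \<in> carrier_mat ?q n"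
      using P1 P2 Q1 Q2 B by auto
    have "P1 * B = (P1 * B * Q1) * P1 + (P1 * B * Q2) * P2" by (rule row[OF P1])
    also have "\<dots> = (P1 * B * Q1) * P1"
      unfolding off(1)[OF that] left_mult_zero_mat[OF P2] by (rule right_add_zero_mat[OF carr(1)])
    finally have "P1 * B = (P1 * B * Q1) * P1" .
    moreover
    have "P2 * B = (P2 * B * Q1) * P1 + (P2 * B * Q2) * P2" by (rule row[OF P2])
    then have "P2 * B = (P2 * B * Q2) * P2"
      unfolding off(2)[OF that] left_mult_zero_mat[OF P1] left_add_zero_mat[OF carr(2)] .
    ultimately have "B = Q1 * ((P1 * B * Q1) * P1) + Q2 * ((P2 * B * Q2) * P2)"
      using one[OF B] by simp
    then show ?thesis using d by (simp add: S_def T_def mult_assoc_dim)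
  qed
  have TS: "T (S XY) = XY" if mem: "XY \<in> C_set A_nil l \<times> C_set A_inv l" for XY
  proof -
    obtain X Y where XY: "XY = (X, Y)" and X: "X \<in> carrier_mat ?p ?p" and Y: "Y \<in> carrier_mat ?q ?q"
      using mem by (auto simp: C_set_iff[OF M1] C_set_iff[OF M2])
    note d = dims carrier_matD[OF X] carrier_matD[OF Y]
    have "P1 * (Q1 * X * P1 + Q2 * Y * P2) * Q1
      = (P1 * Q1) * X * (P1 * Q1) + (P1 * Q2) * Y * (P2 * Q1)"
      using d by (simp add: mat_ring_simps)
    also have "\<dots> = X" unfolding PQ1 PQ12 PQ21 using X Y by simp
    finally have 1: "P1 * (Q1 * X * P1 + Q2 * Y * P2) * Q1 = X" .
    have "P2 * (Q1 * X * P1 + Q2 * Y * P2) * Q2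
      = (P2 * Q1) * X * (P1 * Q2) + (P2 * Q2) * Y * (P2 * Q2)"
      using d by (simp add: mat_ring_simps)
    also have "\<dots> = Y" unfolding PQ2 PQ12 PQ21 using X Y by simp
    finally show ?thesis using 1 by (simp add: T_def S_def XY)
  qed
  have "bij_betw T (C_set A l) (C_set A_nil l \<times> C_set A_inv l)"
    by (rule bij_betwI[where g = S]) (use T_in S_in ST TS in auto)
  moreover have "T (B + C) = (fst (T B) + fst (T C), snd (T B) + snd (T C))"
    if "B \<in> C_set A l" "C \<in> C_set A l" for B C
  proof -
    have "B \<in> carrier_mat n n" "C \<in> carrier_mat n n" using that by (auto simp: C_set_iff[OF A])
    then show ?thesis using dims by (simp add: T_def mat_ring_simps)
  qed
  moreover have "T (c \<cdot>\<^sub>m B) = (c \<cdot>\<^sub>m fst (T B), c \<cdot>\<^sub>m snd (T B))" if "B \<in> C_set A l" for c B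
  proof -
    have "B \<in> carrier_mat n n" using that by (auto simp: C_set_iff[OF A])
    then show ?thesis using dims by (simp add: T_def mat_ring_simps)
  qed
  moreover have "carrier ?D = C_set A_nil l \<times> C_set A_inv l"
    by (simp add: direct_sum_def)
  ultimately have hom: "T \<in> LinearCombinations.module_hom class_ring (C_space A l) ?D"
    and bij: "bij_betw T (carrier (C_space A l)) (carrier ?D)"
    using T_in by (simp_all add: LinearCombinations.module_hom_def direct_sum_def)
  have VA: "vectorspace class_ring (C_space A l)" by (rule C_space_vectorspace[OF A])
  have VD: "vectorspace class_ring ?D"
    by (rule direct_sum_is_vs[OF C_space_vectorspace[OF M1] C_space_vectorspace[OF M2]])
  have "linear_map class_ring (C_space A l) ?D T"
    using VA VD hom unfolding linear_map_def mod_hom_def mod_hom_axioms_def vectorspace_def by blast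
  then show ?thesis using bij unfolding vs_isomorphic_def by blast
qed

end
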